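(* Let $\mathfrak{A}_3=\mathbb{C}\langle u_1,u_2,u_3\rangle$ with indices read modulo $3$. For real parameters $0\le\hbar<\pi$ and $\theta\in\mathbb{R}$, put $q=e^{\mathrm{i}\hbar}$ and let $\mathfrak{I}_{\theta,\hbar}$ be the two-sided ideal generated by $$f_n^{(\theta,\hbar)}=q^{-1}u_nu_{n+1}-q\,u_{n+1}u_n-\mathrm{i}\theta,\qquad n\in\mathbb{Z}_3 .$$ Let $\partial_{t_1}$ be the derivation of $\mathfrak{A}_3$ with $\partial_{t_1}(u_n)=q(u_{n+1}u_n-u_nu_{n-1})$, $n\in\mathbb{Z}_3$. Then: 1. $\mathfrak{I}_{\theta,\hbar}$ is stable under $\partial_{t_1}$ and under the Hermitian conjugation $\dagger$. 2. In $\mathfrak{A}^{(\theta,\hbar)}=\mathfrak{A}_3/\mathfrak{I}_{\theta,\hbar}$ the self-adjoint elements $$H_1=u_1+u_2+u_3,\qquad H_2=\sum_{\sigma\in S_3}u_{\sigma(1)}u_{\sigma(2)}u_{\sigma(3)}$$ are first integrals of the induced system, i.e. $\partial_{t_1}(H_1)=\partial_{t_1}(H_2)=0$, and $$H_2=3(q^2+1)u_3u_2u_1+\mathrm{i}\theta\left((2q+q^{-1})(u_1+u_3)-(q+2q^{-1})u_2\right).$$ 3. The element $\mathcal{H}(\theta,\hbar)=\sin(\hbar)H_2+\theta(2+\cos(2\hbar))H_1$ is central in $\mathfrak{A}^{(\theta,\hbar)}$. 4. In $\mathfrak{A}^{(\theta,\hbar)}$, for all $n\in\mathbb{Z}_3$: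 if $\hbar\neq0$ then $\partial_{t_1}(u_n)=\dfrac{\mathrm{i}}{2\sin\hbar}[H_1,u_n]$, and if $\theta\ne0$ then $\partial_{t_1}(u_n)=-\dfrac{\mathrm{i}}{2\theta(2+\cos(2\hbar))}[H_2,u_n]$. In particular (bi-quantum structure): for $\theta\neq0$, $\hbar=0$, $H_1$ is central in $\mathfrak{A}^{(\theta,0)}$ and $\partial_{t_1}(u_n)=-\frac{\mathrm{i}}{6\theta}[H_2,u_n]$; for $\theta=0$, $0<\hbar<\pi$, $H_2=3(1+q^2)u_3u_2u_1$ is central in $\mathfrak{A}^{(0,\hbar)}$ and $\partial_{t_1}(u_n)=\frac{\mathrm{i}}{2\sin\hbar}[H_1,u_n]$.
   Context: The Hermitian conjugation $\dagger$ on $\mathfrak{A}_3$ is the conjugate-linear anti-automorphism with $u_n^\dagger=u_n$, $\alpha^\dagger=\bar\alpha$ for $\alpha\in\mathbb{C}$, $(ab)^\dagger=b^\dagger a^\dagger$; an ideal is $\dagger$-stable if it is mapped onto itself by $\dagger$, in which case $\dagger$ descends to the quotient. An element $a$ is self-adjoint if $a^\dagger=a$. $[a,b]=ab-ba$. *)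

theory Defs
  imports "HOL-Analysis.Analysis" "HOL-Algebra.QuotRing" "HOL-Algebra.Algebraic_Closure_Type" "HOL-Library.Poly_Mapping"
    "HOL-Library.Numeral_Type" "HOL-Combinatorics.Permutations"
begin

text \<open>
  The free algebra over \<open>\<complex>\<close> on generators indexed by \<open>'x\<close> is the monoid algebra of the free
  monoid on \<open>'x\<close>: finitely supported functions from words to \<open>\<complex>\<close> with the convolution product
  provided by \<^theory>\<open>HOL-Library.Poly_Mapping\<close>. That theory writes the monoid additively (without
  assuming commutativity), so concatenation of words is \<open>+\<close> and the empty word is \<open>0\<close>.
\<close>

datatype 'x free_monoid = Free_Word (letters: "'x list")

instantiation free_monoid :: (type) monoid_add
begin

definition zero_free_monoid :: "'a free_monoid"
  where "0 = Free_Word []"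

definition plus_free_monoid :: "'a free_monoid \<Rightarrow> 'a free_monoid \<Rightarrow> 'a free_monoid"
  where "v + w = Free_Word (letters v @ letters w)"

instance
  by standard (simp_all add: zero_free_monoid_def plus_free_monoid_def)

end

type_synonym 'x free_alg = "'x free_monoid \<Rightarrow>\<^sub>0 complex"

definition scal :: "complex \<Rightarrow> 'x free_alg"
  where "scal c = Poly_Mapping.single 0 c"

definition gen :: "'x \<Rightarrow> 'x free_alg"
  where "gen n = Poly_Mapping.single (Free_Word [n]) 1"

definition derivation :: "('x free_alg \<Rightarrow> 'x free_alg) \<Rightarrow> bool"
  where "derivation D \<longleftrightarrow>
    (\<forall>a b. D (a + b) = D a + D b) \<and>
    (\<forall>c a. D (scal c * a) = scal c * D a) \<and>
    (\<forall>a b. D (a * b) = D a * b + a * D b)"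

definition conj_linear_antiautomorphism :: "('x free_alg \<Rightarrow> 'x free_alg) \<Rightarrow> bool"
  where "conj_linear_antiautomorphism f \<longleftrightarrow>
    bij f \<and>
    (\<forall>a b. f (a + b) = f a + f b) \<and>
    (\<forall>c a. f (scal c * a) = scal (cnj c) * f a) \<and>
    (\<forall>a b. f (a * b) = f b * f a)"

text \<open>
  The index set \<open>\<int>\<^sub>3\<close> is the numeral type \<^typ>\<open>3\<close>, whose arithmetic is modulo 3;
  in particular \<^term>\<open>3 :: 3\<close> is \<^term>\<open>0 :: 3\<close>.
\<close>

type_synonym A3 = "3 free_alg"

definition u :: "3 \<Rightarrow> A3"
  where "u = gen"

definition qpar :: "real \<Rightarrow> complex"
  where "qpar h = exp (\<i> * complex_of_real h)"

text \<open>
  Both maps below are defined by the properties that determine them on the free algebra; existence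
  and uniqueness are shown in \<open>ex1_derivation\<close> and \<open>ex1_conj_linear_antiautomorphism\<close>.
\<close>

definition dt1 :: "real \<Rightarrow> A3 \<Rightarrow> A3"
  where "dt1 h = (THE D. derivation D \<and>
    (\<forall>n. D (u n) = scal (qpar h) * (u (n + 1) * u n - u n * u (n - 1))))"

definition dagger :: "A3 \<Rightarrow> A3"
  where "dagger = (THE f. conj_linear_antiautomorphism f \<and> (\<forall>n. f (u n) = u n))"

definition rel_gen :: "real \<Rightarrow> real \<Rightarrow> 3 \<Rightarrow> A3"
  where "rel_gen \<theta> h n =
    scal (inverse (qpar h)) * u n * u (n + 1) - scal (qpar h) * u (n + 1) * u n
      - scal (\<i> * complex_of_real \<theta>)"

abbreviation A3_ring :: "A3 ring"
  where "A3_ring \<equiv> ring_of_type_algebra"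

definition rel_ideal :: "real \<Rightarrow> real \<Rightarrow> A3 set"
  where "rel_ideal \<theta> h = genideal A3_ring (range (rel_gen \<theta> h))"

definition quot_alg :: "real \<Rightarrow> real \<Rightarrow> A3 set ring"
  where "quot_alg \<theta> h = A3_ring Quot rel_ideal \<theta> h"

definition quot_class :: "real \<Rightarrow> real \<Rightarrow> A3 \<Rightarrow> A3 set"
  where "quot_class \<theta> h a = rel_ideal \<theta> h +>\<^bsub>A3_ring\<^esub> a"

text \<open>
  The map induced on the quotient by \<open>f\<close>. It is meaningful only if \<open>f\<close> respects congruence
  modulo the ideal, i.e. if all representatives of a class yield the same value.
\<close>

definition quot_map :: "real \<Rightarrow> real \<Rightarrow> (A3 \<Rightarrow> A3) \<Rightarrow> A3 set \<Rightarrow> A3 set"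
  where "quot_map \<theta> h f C = the_elem ((\<lambda>a. quot_class \<theta> h (f a)) ` C)"

definition quot_scale :: "real \<Rightarrow> real \<Rightarrow> complex \<Rightarrow> A3 set \<Rightarrow> A3 set"
  where "quot_scale \<theta> h c C = quot_class \<theta> h (scal c) \<otimes>\<^bsub>quot_alg \<theta> h\<^esub> C"

definition ring_commutator :: "('a, 'm) ring_scheme \<Rightarrow> 'a \<Rightarrow> 'a \<Rightarrow> 'a"
  where "ring_commutator R a b = (a \<otimes>\<^bsub>R\<^esub> b) \<ominus>\<^bsub>R\<^esub> (b \<otimes>\<^bsub>R\<^esub> a)"

definition ring_central :: "('a, 'm) ring_scheme \<Rightarrow> 'a \<Rightarrow> bool"
  where "ring_central R z \<longleftrightarrow>
    z \<in> carrier R \<and> (\<forall>x\<in>carrier R. z \<otimes>\<^bsub>R\<^esub> x = x \<otimes>\<^bsub>R\<^esub> z)"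

definition H1 :: A3
  where "H1 = u 1 + u 2 + u 3"

definition H2 :: A3
  where "H2 = (\<Sum>s | s permutes (UNIV :: 3 set). u (s 1) * u (s 2) * u (s 3))"

definition H_central :: "real \<Rightarrow> real \<Rightarrow> A3"
  where "H_central \<theta> h =
    scal (of_real (sin h)) * H2 + scal (of_real (\<theta> * (2 + cos (2 * h)))) * H1"

subsection \<open>Existence and uniqueness of the defining maps\<close>

lemma scal_mult: "scal a * scal b = scal (a * b)"
  by (simp add: scal_def mult_single)

lemma scal_add: "scal (a + b) = scal a + scal b"
  by (simp add: scal_def single_add)

lemma scal_0 [simp]: "scal 0 = 0"
  by (simp add: scal_def)

lemma scal_1 [simp]: "scal 1 = 1"
  by (simp add: scal_def)

lemma scal_single: "scal c * Poly_Mapping.single w d = Poly_Mapping.single w (c * d)"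
  by (simp add: scal_def mult_single)

lemma free_alg_induct [case_names single add]:
  fixes p :: "'x free_alg"
  assumes s: "\<And>w c. P (Poly_Mapping.single w c)"
    and a: "\<And>p r. P p \<Longrightarrow> P r \<Longrightarrow> P (p + r)"
  shows "P p"
proof (induction p rule: update_induct)
  case const
  then show ?case using s[of 0 0] by simp
next
  case (update f k v)
  have "Poly_Mapping.update k v f = Poly_Mapping.single k v + f"
    using update(1) by (intro poly_mapping_eqI)
      (auto simp: lookup_update lookup_add lookup_single when_def in_keys_iff)
  then show ?case using a s update by metis
qed

lemma scal_commute: "scal c * p = p * scal c"
  by (induction p rule: free_alg_induct)
    (simp_all add: scal_def mult_single mult.commute algebra_simps)

lemma scal_left_commute: "p * (scal c * r) = scal c * (p * r)"
  by (metis mult.assoc scal_commute)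

lemma single_Cons:
  "Poly_Mapping.single (Free_Word (x # xs)) c = scal c * (gen x * Poly_Mapping.single (Free_Word xs) 1)"
  by (simp add: scal_def gen_def mult_single plus_free_monoid_def zero_free_monoid_def)

definition lin_ext :: "(complex \<Rightarrow> complex) \<Rightarrow> ('x free_monoid \<Rightarrow> 'x free_alg) \<Rightarrow> 'x free_alg \<Rightarrow> 'x free_alg"
  where "lin_ext s F p = (\<Sum>w\<in>Poly_Mapping.keys p. scal (s (Poly_Mapping.lookup p w)) * F w)"

lemma lin_ext_single:
  assumes "s 0 = 0"
  shows "lin_ext s F (Poly_Mapping.single w c) = scal (s c) * F w"
  using assms by (simp add: lin_ext_def)

lemma lin_ext_superset:
  assumes "s 0 = 0" "finite S" "Poly_Mapping.keys p \<subseteq> S"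
  shows "lin_ext s F p = (\<Sum>w\<in>S. scal (s (Poly_Mapping.lookup p w)) * F w)"
  unfolding lin_ext_def using assms
  by (intro sum.mono_neutral_left) (auto simp: in_keys_iff)

lemma lin_ext_add:
  assumes s: "s 0 = 0" "\<And>a b. s (a + b) = s a + s b"
  shows "lin_ext s F (p + r) = lin_ext s F p + lin_ext s F r"
proof -
  let ?S = "Poly_Mapping.keys p \<union> Poly_Mapping.keys r"
  have "Poly_Mapping.keys (p + r) \<subseteq> ?S" by (rule keys_add)
  then have "lin_ext s F (p + r) = (\<Sum>w\<in>?S. scal (s (Poly_Mapping.lookup (p + r) w)) * F w)"
    using s by (intro lin_ext_superset) auto
  also have "\<dots> = (\<Sum>w\<in>?S. scal (s (Poly_Mapping.lookup p w)) * F w) + (\<Sum>w\<in>?S. scal (s (Poly_Mapping.lookup r w)) * F w)"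
    by (simp add: lookup_add s scal_add algebra_simps sum.distrib)
  also have "\<dots> = lin_ext s F p + lin_ext s F r"
    using s by (simp add: lin_ext_superset[of s ?S])
  finally show ?thesis .
qed

fun deriv_word :: "('x \<Rightarrow> 'x free_alg) \<Rightarrow> 'x list \<Rightarrow> 'x free_alg"
  where
    "deriv_word d [] = 0"
  | "deriv_word d (x # xs) =
      d x * Poly_Mapping.single (Free_Word xs) 1 + gen x * deriv_word d xs"

lemma deriv_word_append:
  "deriv_word d (xs @ ys) =
    deriv_word d xs * Poly_Mapping.single (Free_Word ys) 1 +
    Poly_Mapping.single (Free_Word xs) 1 * deriv_word d ys"
proof (induction xs)
  case Nil
  have "Poly_Mapping.single (Free_Word []) 1 = (1 :: 'a free_alg)"
    by (simp flip: zero_free_monoid_def)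
  then show ?case by simp
next
  case (Cons x xs)
  have "Poly_Mapping.single (Free_Word (xs @ ys)) 1 =
      Poly_Mapping.single (Free_Word xs) 1 * (Poly_Mapping.single (Free_Word ys) 1 :: 'a free_alg)"
    by (simp add: mult_single plus_free_monoid_def)
  with Cons show ?case
    by (simp add: single_Cons[of x xs] algebra_simps)
qed

theorem ex1_derivation: "\<exists>!D. derivation D \<and> (\<forall>n. D (gen n) = d n)"
proof (rule ex_ex1I)
  define D where "D = lin_ext (\<lambda>c. c) (\<lambda>w. deriv_word d (letters w))"
  have D_add: "D (a + b) = D a + D b" for a b
    by (simp add: D_def lin_ext_add)
  have D_single: "D (Poly_Mapping.single w c) = scal c * deriv_word d (letters w)" for w c
    by (simp add: D_def lin_ext_single)
  have scale: "D (scal c * a) = scal c * D a" for c a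
  proof (induction a rule: free_alg_induct)
    case (single w e)
    show ?case
      by (simp add: scal_single D_single mult.assoc flip: scal_mult)
  next
    case (add p r)
    then show ?case
      by (simp add: D_add distrib_left)
  qed
  have mult_single1: "D (Poly_Mapping.single v c * Poly_Mapping.single w e) =
      D (Poly_Mapping.single v c) * Poly_Mapping.single w e +
      Poly_Mapping.single v c * D (Poly_Mapping.single w e)" for v w c e
  proof -
    have v: "Poly_Mapping.single v c = scal c * Poly_Mapping.single v 1"
      and w: "Poly_Mapping.single w e = scal e * Poly_Mapping.single w 1"
      by (simp_all add: scal_single)
    have "D (Poly_Mapping.single v c * Poly_Mapping.single w e) =
        scal c * (scal e * deriv_word d (letters v @ letters w))"
      by (simp add: mult_single D_single plus_free_monoid_def mult.assoc flip: scal_mult)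
    also have "\<dots> = scal c * (scal e * (deriv_word d (letters v) * Poly_Mapping.single w 1
        + Poly_Mapping.single v 1 * deriv_word d (letters w)))"
      by (simp add: deriv_word_append)
    also have "\<dots> = (scal c * deriv_word d (letters v)) * (scal e * Poly_Mapping.single w 1)
        + (scal c * Poly_Mapping.single v 1) * (scal e * deriv_word d (letters w))"
      by (simp add: mult.assoc distrib_left scal_left_commute[of "deriv_word d (letters v)"]
          scal_left_commute[of "Poly_Mapping.single v 1"])
    finally show ?thesis
      by (simp add: D_single flip: v w)
  qed
  have mult_single2: "D (Poly_Mapping.single v c * b) =
      D (Poly_Mapping.single v c) * b + Poly_Mapping.single v c * D b" for v c b
    by (induction b rule: free_alg_induct) (simp_all add: mult_single1 D_add distrib_left)
  have mult: "D (a * b) = D a * b + a * D b" for a b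
    by (induction a rule: free_alg_induct) (simp_all add: mult_single2 D_add distrib_right)
  have "D (gen n) = d n" for n
    using D_single[of "Free_Word [n]" 1]
    by (simp add: gen_def flip: zero_free_monoid_def)
  then show "\<exists>D. derivation D \<and> (\<forall>n. D (gen n) = d n)"
    using D_add scale mult unfolding derivation_def by blast
next
  fix D E
  assume D: "derivation D \<and> (\<forall>n. D (gen n) = d n)"
    and E: "derivation E \<and> (\<forall>n. E (gen n) = d n)"
  have one: "F 1 = 0" if "derivation F" for F :: "'a free_alg \<Rightarrow> 'a free_alg"
  proof -
    have "F (1 * 1) = F 1 * 1 + 1 * F 1"
      using that unfolding derivation_def by blast
    then show ?thesis by simp
  qed
  have word: "D (Poly_Mapping.single (Free_Word xs) 1) = E (Poly_Mapping.single (Free_Word xs) 1)" for xs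
  proof (induction xs)
    case Nil
    have "Poly_Mapping.single (Free_Word []) 1 = (1 :: 'a free_alg)"
      by (simp flip: zero_free_monoid_def)
    then show ?case using one[of D] one[of E] D E by simp
  next
    case (Cons x xs)
    then show ?case using D E by (simp add: single_Cons derivation_def)
  qed
  have "D (Poly_Mapping.single w c) = E (Poly_Mapping.single w c)" for w c
  proof -
    have "Poly_Mapping.single w c = scal c * Poly_Mapping.single (Free_Word (letters w)) 1"
      by (simp add: scal_single)
    then show ?thesis using D E word unfolding derivation_def by metis
  qed
  moreover have "D (p + r) = D p + D r" "E (p + r) = E p + E r" for p r
    using D E by (simp_all add: derivation_def)
  ultimately have "D p = E p" for p
    by (induction p rule: free_alg_induct) simp_all
  then show "D = E" by blast
qed

theorem ex1_conj_linear_antiautomorphism: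
  "\<exists>!f. conj_linear_antiautomorphism f \<and> (\<forall>n. f (gen n) = gen n)"
proof (rule ex_ex1I)
  define f :: "'a free_alg \<Rightarrow> 'a free_alg" where
    "f = lin_ext cnj (\<lambda>w. Poly_Mapping.single (Free_Word (rev (letters w))) 1)"
  have add: "f (a + b) = f a + f b" for a b
    by (simp add: f_def lin_ext_add)
  have single: "f (Poly_Mapping.single w c) = Poly_Mapping.single (Free_Word (rev (letters w))) (cnj c)" for w c
    by (simp add: f_def lin_ext_single scal_single)
  have scale: "f (scal c * a) = scal (cnj c) * f a" for c a
    by (induction a rule: free_alg_induct)
      (simp_all add: scal_single single add distrib_left)
  have mult_single2: "f (Poly_Mapping.single v c * b) = f b * f (Poly_Mapping.single v c)" for v c b
    by (induction b rule: free_alg_induct)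
      (simp_all add: mult_single single plus_free_monoid_def add distrib_left distrib_right,
        simp add: mult.commute)
  have mult: "f (a * b) = f b * f a" for a b
    by (induction a rule: free_alg_induct) (simp_all add: mult_single2 add distrib_left distrib_right)
  have "f (f a) = a" for a
    by (induction a rule: free_alg_induct) (simp_all add: single add)
  then have "bij f" by (metis bijI')
  moreover have "f (gen n) = gen n" for n
    by (simp add: gen_def single)
  ultimately show "\<exists>f. conj_linear_antiautomorphism f \<and> (\<forall>n. f (gen n) = (gen n :: 'a free_alg))"
    using add scale mult unfolding conj_linear_antiautomorphism_def by blast
next
  fix D E :: "'a free_alg \<Rightarrow> 'a free_alg"
  assume D: "conj_linear_antiautomorphism D \<and> (\<forall>n. D (gen n) = gen n)"
    and E: "conj_linear_antiautomorphism E \<and> (\<forall>n. E (gen n) = gen n)"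
  have one: "F 1 = 1" if F: "conj_linear_antiautomorphism F" for F :: "'a free_alg \<Rightarrow> 'a free_alg"
  proof -
    obtain a where a: "F a = 1"
      using F unfolding conj_linear_antiautomorphism_def by (metis bij_pointE)
    have "F (a * 1) = F 1 * F a"
      using F unfolding conj_linear_antiautomorphism_def by blast
    then show ?thesis using a by simp
  qed
  have word: "D (Poly_Mapping.single (Free_Word xs) 1) = E (Poly_Mapping.single (Free_Word xs) 1)" for xs
  proof (induction xs)
    case Nil
    have "Poly_Mapping.single (Free_Word []) 1 = (1 :: 'a free_alg)"
      by (simp flip: zero_free_monoid_def)
    then show ?case using one[of D] one[of E] D E by simp
  next
    case (Cons x xs)
    then show ?case using D E by (simp add: single_Cons conj_linear_antiautomorphism_def)
  qed
  have "D (Poly_Mapping.single w c) = E (Poly_Mapping.single w c)" for w c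
  proof -
    have "Poly_Mapping.single w c = scal c * Poly_Mapping.single (Free_Word (letters w)) 1"
      by (simp add: scal_single)
    then show ?thesis using D E word unfolding conj_linear_antiautomorphism_def by metis
  qed
  moreover have "D (p + r) = D p + D r" "E (p + r) = E p + E r" for p r
    using D E by (simp_all add: conj_linear_antiautomorphism_def)
  ultimately have "D p = E p" for p
    by (induction p rule: free_alg_induct) simp_all
  then show "D = E" by blast
qed

lemma
  derivation_dt1: "derivation (dt1 h)" and
  dt1_gen: "dt1 h (u n) = scal (qpar h) * (u (n + 1) * u n - u n * u (n - 1))"
  using theI'[OF ex1_derivation[of "\<lambda>n. scal (qpar h) * (u (n + 1) * u n - u n * u (n - 1))"]]
  by (simp_all add: dt1_def u_def)

lemma
  conj_linear_antiautomorphism_dagger: "conj_linear_antiautomorphism dagger" and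
  dagger_gen: "dagger (u n) = u n"
  using theI'[OF ex1_conj_linear_antiautomorphism[where ?'a = 3]]
  by (simp_all add: dagger_def u_def)

end

theory Submission
  imports Defs
begin

text \<open>
  Everything reduces to congruences modulo the ideal between noncommutative
  polynomials of degree at most four in \<open>u\<^sub>n\<close>, \<open>u\<^sub>n\<^sub>+\<^sub>1\<close>, \<open>u\<^sub>n\<^sub>-\<^sub>1\<close>, and each such congruence is certified by an explicit
  combination of the relations. The two decisive ones, valid for all parameters, are
  \<open>[H\<^sub>1, u\<^sub>n] \<equiv> -2\<i> sin \<hbar> \<partial>u\<^sub>n\<close> and \<open>[H\<^sub>2, u\<^sub>n] \<equiv> 2\<i>\<theta> (2 + cos 2\<hbar>) \<partial>u\<^sub>n\<close>: dividing by the scalars gives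
  the Heisenberg forms, and in the combination \<open>\<H>\<close> the right-hand sides cancel, so that it commutes
  with the generators.
\<close>

section \<open>Certificates in a noncommutative ring\<close>

text \<open>
  \<open>P\<close>, \<open>Q\<close>, \<open>T\<close> stand for the scalars \<open>q\<^sup>-\<^sup>1\<close>, \<open>q\<close>, \<open>\<i>\<theta>\<close>, and \<open>x\<close>, \<open>y\<close>, \<open>z\<close> for \<open>u\<^sub>n\<close>, \<open>u\<^sub>n\<^sub>+\<^sub>1\<close>, \<open>u\<^sub>n\<^sub>-\<^sub>1\<close>. Below,
  \<open>a\<close>, \<open>b\<close>, \<open>c\<close> are the three relations and \<open>S\<close> is \<open>H\<^sub>2\<close>.
\<close>

locale q_cyclic_triple =
  fixes P Q T x y z :: "'a::ring_1"
  assumes comm: "x * P = P * x" "y * P = P * y" "z * P = P * z"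
    "x * Q = Q * x" "y * Q = Q * y" "z * Q = Q * z"
    "x * T = T * x" "y * T = T * y" "z * T = T * z"
    "T * P = P * T" "T * Q = Q * T"
    and inverse: "P * Q = 1" "Q * P = 1"
begin

text \<open>Right-nested companions of \<open>comm\<close> and \<open>inverse\<close>: after
  reassociation, scalars still move left and \<open>P\<close>, \<open>Q\<close> cancel inside longer
  words.\<close>

lemma left_comm: "x * (P * r) = P * (x * r)" "y * (P * r) = P * (y * r)" "z * (P * r) = P * (z * r)"
  "x * (Q * r) = Q * (x * r)" "y * (Q * r) = Q * (y * r)" "z * (Q * r) = Q * (z * r)"
  "x * (T * r) = T * (x * r)" "y * (T * r) = T * (y * r)" "z * (T * r) = T * (z * r)"
  "T * (P * r) = P * (T * r)" "T * (Q * r) = Q * (T * r)"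
  "P * (Q * r) = r" "Q * (P * r) = r"
  by (simp_all add: comm inverse flip: mult.assoc)

abbreviation a where "a \<equiv> P * x * y - Q * y * x - T"
abbreviation b where "b \<equiv> P * y * z - Q * z * y - T"
abbreviation c where "c \<equiv> P * z * x - Q * x * z - T"
abbreviation dx where "dx \<equiv> Q * (y * x - x * z)"
abbreviation dy where "dy \<equiv> Q * (z * y - y * x)"
abbreviation dz where "dz \<equiv> Q * (x * z - z * y)"
abbreviation S where "S \<equiv> x * y * z + x * z * y + y * x * z + y * z * x + z * x * y + z * y * x"

text \<open>Integer coefficients become repeated sums, so that certificates are compared monomial by
  monomial.\<close>

lemma numeral_mult: "2 * r = r + r" "3 * r = r + r + r" "4 * r = r + r + r + r" for r :: 'a
  by (simp_all only: numeral.simps distrib_right mult_1_left add.assoc)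

text \<open>
  The right-hand sides below come from rewriting the left-hand sides to the normal order \<open>zyx\<close>
  by \<open>xy = q\<^sup>2yx + qT + qa\<close> and its analogues, keeping track of the multiples of the relations;
  that of \<open>d_S\<close> was then made cyclically symmetric.
\<close>

lemma d_relation:
  "P * (dx * y + x * dy) - Q * (dy * x + y * dx) = Q * (y * a - a * x + b * x - y * c)"
  by (simp add: algebra_simps comm left_comm inverse)

lemma d_S:
  "dx * y * z + x * dy * z + x * y * dz + (dx * z * y + x * dz * y + x * z * dy)
    + (dy * x * z + y * dx * z + y * x * dz) + (dy * z * x + y * dz * x + y * z * dx)
    + (dz * x * y + z * dx * y + z * x * dy) + (dz * y * x + z * dy * x + z * y * dx) =
   x * (b * y + y * b + z * a - c * y) - a * (y * z + z * y)
   + y * (c * z + z * c + x * b - a * z) - b * (z * x + x * z)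
   + z * (a * x + x * a + y * c - b * x) - c * (x * y + y * x)"
  by (simp add: algebra_simps comm left_comm inverse)

lemma S_reduced:
  "S - (3 * (Q * Q + 1) * z * y * x + T * ((2 * Q + P) * (x + z) - (Q + 2 * P) * y)) =
   (P + Q) * b * x - (P + Q) * c * y + Q * x * b - P * y * c + (P + 2 * Q) * z * a"
  by (simp add: algebra_simps comm left_comm inverse numeral_mult)

lemma comm_sum: "(x + y + z) * x - x * (x + y + z) - (P - Q) * dx = Q * (c - a)"
  by (simp add: algebra_simps comm left_comm inverse numeral_mult)

lemma comm_S: "S * x - x * S - T * (4 + Q * Q + P * P) * dx =
   2 * T * (a - c) - Q * Q * Q * a * x * z - P * a * z * x + (P + Q) * c * y * x - Q * x * a * z
   + P * x * c * y + P * x * y * c - (P + Q) * x * z * a + Q * y * c * x + Q * Q * Q * y * x * c - P * z * a * x"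
  by (simp add: algebra_simps comm left_comm inverse numeral_mult)

end

section \<open>Ring-theoretic preliminaries\<close>

lemma ring_of_type_algebra_simps [simp]:
  "carrier ring_of_type_algebra = (UNIV :: 'a::ring_1 set)"
  "mult ring_of_type_algebra = ((*) :: 'a \<Rightarrow> 'a \<Rightarrow> 'a)"
  "one ring_of_type_algebra = (1 :: 'a)"
  "ring.zero ring_of_type_algebra = (0 :: 'a)"
  "add ring_of_type_algebra = ((+) :: 'a \<Rightarrow> 'a \<Rightarrow> 'a)"
  by (simp_all add: ring_of_type_algebra_def)

lemma ring_ring_of_type_algebra: "ring (ring_of_type_algebra :: 'a::ring_1 ring)"
proof -
  have "\<exists>y. x + y = 0" for x :: 'a
    using add.right_inverse by blast
  then show ?thesis
    unfolding ring_of_type_algebra_def using add.right_inverse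
    by unfold_locales (auto simp: algebra_simps Units_def)
qed

lemma a_inv_ring_of_type_algebra [simp]:
  "\<ominus>\<^bsub>ring_of_type_algebra\<^esub> a = - (a :: 'a::ring_1)"
proof -
  interpret ring "ring_of_type_algebra :: 'a ring"
    by (rule ring_ring_of_type_algebra)
  show ?thesis
    using minus_equality[of "- a" a] by simp
qed

lemma ideal_ring_of_type_algebraI:
  fixes J :: "'a::ring_1 set"
  assumes zero_mem: "0 \<in> J"
    and add_mem: "\<And>a b. a \<in> J \<Longrightarrow> b \<in> J \<Longrightarrow> a + b \<in> J"
    and mult_left: "\<And>a r. a \<in> J \<Longrightarrow> r * a \<in> J"
    and mult_right: "\<And>a r. a \<in> J \<Longrightarrow> a * r \<in> J"
  shows "ideal J ring_of_type_algebra"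
proof (rule idealI)
  show "ring (ring_of_type_algebra :: 'a ring)"
    by (rule ring_ring_of_type_algebra)
  then interpret ring "ring_of_type_algebra :: 'a ring" .
  have uminus: "- a \<in> J" if "a \<in> J" for a
    using mult_left[OF that, of "- 1"] by simp
  show "subgroup J (add_monoid (ring_of_type_algebra :: 'a ring))"
    using zero_mem add_mem uminus by (intro add.subgroupI) (auto simp flip: a_inv_def)
qed (use mult_left mult_right in auto)

text \<open>Follows the algebra structure rather than the basis of words, for properties known on
  scalars and generators.\<close>

lemma free_alg_induct_gen [case_names scal gen add mult]:
  fixes p :: "'x free_alg"
  assumes scal: "\<And>c. R (scal c)" and gen: "\<And>n. R (gen n)"
    and add: "\<And>p r. R p \<Longrightarrow> R r \<Longrightarrow> R (p + r)"
    and mult: "\<And>p r. R p \<Longrightarrow> R r \<Longrightarrow> R (p * r)"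
  shows "R p"
proof (induction p rule: free_alg_induct)
  case (single w c)
  have "R (Poly_Mapping.single (Free_Word xs) c)" for xs c
  proof (induction xs arbitrary: c)
    case Nil
    then show ?case
      using scal[of c] by (simp add: scal_def zero_free_monoid_def)
  next
    case (Cons x xs)
    then show ?case
      unfolding single_Cons by (intro mult scal gen)
  qed
  then show ?case
    by (metis free_monoid.exhaust)
qed (rule add)

lemma scal_numeral: "scal (numeral k) = (numeral k :: 'x free_alg)"
proof -
  have "scal (of_nat m) = (of_nat m :: 'x free_alg)" for m
    by (induction m) (simp_all add: scal_add)
  from this[of "numeral k"] show ?thesis
    by simp
qed

lemma scal_minus: "scal (a - b) = scal a - scal b"
  by (simp add: eq_diff_eq flip: scal_add)

lemma scal_uminus: "scal (- a) = - scal a"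
  using scal_minus[of 0 a] by simp

section \<open>Cyclic symmetry of the indices and of the first integrals\<close>

lemma cyclic_indices [simp]:
  fixes n :: 3
  shows "n + 1 + 1 = n - 1" "n - 1 - 1 = n + 1"
  using exhaust_3[of n] by auto

lemma u_wrap: "u 0 = u 3" "u 4 = u 1"
  by (rule arg_cong[where f = u], simp)+

text \<open>A cyclic shift only permutes the summands. With the analogue for \<open>H2\<close>, one
  computation at a general \<open>n\<close> covers all three generators.\<close>

lemma H1_cyclic: "H1 = u n + u (n + 1) + u (n - 1)"
  using exhaust_3[of n] by (auto simp: H1_def u_wrap algebra_simps)

lemma H2_expand:
  "H2 = u 1 * u 2 * u 3 + u 1 * u 3 * u 2 + u 2 * u 1 * u 3
    + u 2 * u 3 * u 1 + u 3 * u 1 * u 2 + u 3 * u 2 * u 1"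
proof -
  have "finite {2::3, 3}" "1 \<notin> {2::3, 3}" "finite {3::3}" "2 \<notin> {3::3}"
    by auto
  then show ?thesis
    unfolding H2_def UNIV_3
    by (simp add: sum_over_permutations_insert permutes_sing transpose_def algebra_simps)
qed

lemma H2_cyclic:
  "H2 = u n * u (n + 1) * u (n - 1) + u n * u (n - 1) * u (n + 1) + u (n + 1) * u n * u (n - 1)
    + u (n + 1) * u (n - 1) * u n + u (n - 1) * u n * u (n + 1) + u (n - 1) * u (n + 1) * u n"
  using exhaust_3[of n] by (auto simp: H2_expand u_wrap algebra_simps)

section \<open>Identities for the unimodular parameter \<open>qpar h\<close>\<close>

lemma qpar_nonzero [simp]: "qpar h \<noteq> 0"
  by (simp add: qpar_def)

lemma inverse_qpar: "inverse (qpar h) = cnj (qpar h)"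
  by (simp add: qpar_def exp_cnj flip: exp_minus)

lemma qpar_cis: "qpar h = cis h"
  by (simp add: qpar_def cis_conv_exp)

lemma inverse_qpar_minus_qpar: "inverse (qpar h) - qpar h = - 2 * \<i> * of_real (sin h)"
  by (simp add: inverse_qpar qpar_cis complex_eq_iff)

lemma qpar_squares: "qpar h * qpar h + inverse (qpar h) * inverse (qpar h) = 2 * of_real (cos (2 * h))"
  by (simp add: inverse_qpar qpar_cis cis_mult cis_cnj complex_eq_iff)


section \<open>The derivation and the Hermitian conjugation on the free algebra\<close>

lemma derivation_one: "derivation D \<Longrightarrow> D 1 = 0"
proof -
  assume "derivation D"
  then have "D (1 * 1) = D 1 * 1 + 1 * D 1"
    unfolding derivation_def by blast
  then show "D 1 = 0" by simp
qed

lemma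
  dt1_add: "dt1 h (a + b) = dt1 h a + dt1 h b" and
  dt1_scal_mult: "dt1 h (scal k * a) = scal k * dt1 h a" and
  dt1_mult: "dt1 h (a * b) = dt1 h a * b + a * dt1 h b"
  using derivation_dt1[of h] unfolding derivation_def by blast+

lemma dt1_scal: "dt1 h (scal k) = 0"
  using dt1_scal_mult[of h k 1] derivation_one[OF derivation_dt1] by simp

lemma dt1_diff: "dt1 h (a - b) = dt1 h a - dt1 h b"
  using dt1_add[of h "a - b" b] by (simp add: eq_diff_eq)

lemma
  dagger_add: "dagger (a + b) = dagger a + dagger b" and
  dagger_scal_mult: "dagger (scal k * a) = scal (cnj k) * dagger a" and
  dagger_mult: "dagger (a * b) = dagger b * dagger a" and
  bij_dagger: "bij dagger"
  using conj_linear_antiautomorphism_dagger unfolding conj_linear_antiautomorphism_def by blast+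

lemma dagger_scal: "dagger (scal k) = scal (cnj k)"
proof -
  obtain a where a: "dagger a = 1"
    using bij_dagger by (metis bij_pointE)
  \<comment> \<open>In \<open>dagger (a * 1) = dagger 1 * dagger a\<close> the left side is 1 and
    the right side is \<open>dagger 1\<close>.\<close>
  have "dagger 1 = 1"
    using dagger_mult[of a 1] a by simp
  then show ?thesis
    using dagger_scal_mult[of k 1] by simp
qed

lemma dagger_diff: "dagger (a - b) = dagger a - dagger b"
  using dagger_add[of "a - b" b] by (simp add: eq_diff_eq)

lemma dagger_dagger: "dagger (dagger a) = a"
  by (induction a rule: free_alg_induct_gen)
    (simp_all add: dagger_scal dagger_add dagger_mult flip: u_def, simp_all add: dagger_gen)

text \<open>Reversal exchanges the two quadratic monomials and conjugation exchanges q with its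
  inverse; the imaginary constant also changes sign.\<close>

lemma dagger_rel_gen: "dagger (rel_gen \<theta> h n) = - rel_gen \<theta> h n"
  by (simp add: rel_gen_def dagger_diff dagger_mult dagger_gen dagger_scal inverse_qpar
      scal_uminus mult.assoc scal_left_commute flip: scal_commute)

lemma dagger_H1: "dagger H1 = H1"
  by (simp add: H1_def dagger_add dagger_gen)

lemma dagger_H2: "dagger H2 = H2"
  by (simp add: H2_expand dagger_add dagger_mult dagger_gen mult.assoc)

section \<open>Congruences modulo the ideal of relations\<close>

lemma ideal_rel_ideal: "ideal (rel_ideal \<theta> h) A3_ring"
  unfolding rel_ideal_def by (intro ring.genideal_ideal ring_ring_of_type_algebra) simp

lemma rel_gen_in_rel_ideal: "rel_gen \<theta> h n \<in> rel_ideal \<theta> h"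
  using ring.genideal_self[OF ring_ring_of_type_algebra, of "range (rel_gen \<theta> h)"]
  by (auto simp: rel_ideal_def)

lemma
  rel_ideal_zero: "0 \<in> rel_ideal \<theta> h" and
  rel_ideal_add: "a \<in> rel_ideal \<theta> h \<Longrightarrow> b \<in> rel_ideal \<theta> h \<Longrightarrow> a + b \<in> rel_ideal \<theta> h" and
  rel_ideal_uminus: "a \<in> rel_ideal \<theta> h \<Longrightarrow> - a \<in> rel_ideal \<theta> h" and
  rel_ideal_mult_left: "a \<in> rel_ideal \<theta> h \<Longrightarrow> r * a \<in> rel_ideal \<theta> h" and
  rel_ideal_mult_right: "a \<in> rel_ideal \<theta> h \<Longrightarrow> a * r \<in> rel_ideal \<theta> h"
proof -
  have I: "ideal (rel_ideal \<theta> h) A3_ring"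
    by (rule ideal_rel_ideal)
  then have S: "additive_subgroup (rel_ideal \<theta> h) A3_ring"
    by (rule ideal.axioms)
  show "0 \<in> rel_ideal \<theta> h"
    "a \<in> rel_ideal \<theta> h \<Longrightarrow> b \<in> rel_ideal \<theta> h \<Longrightarrow> a + b \<in> rel_ideal \<theta> h"
    "a \<in> rel_ideal \<theta> h \<Longrightarrow> - a \<in> rel_ideal \<theta> h"
    "a \<in> rel_ideal \<theta> h \<Longrightarrow> r * a \<in> rel_ideal \<theta> h"
    "a \<in> rel_ideal \<theta> h \<Longrightarrow> a * r \<in> rel_ideal \<theta> h"
    using additive_subgroup.zero_closed[OF S] additive_subgroup.a_closed[OF S, of a b]
      additive_subgroup.a_inv_closed[OF S, of a]
      ideal.I_l_closed[OF I, of a r] ideal.I_r_closed[OF I, of a r]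
    by simp_all
qed

lemma rel_ideal_diff:
  "a \<in> rel_ideal \<theta> h \<Longrightarrow> b \<in> rel_ideal \<theta> h \<Longrightarrow> a - b \<in> rel_ideal \<theta> h"
  using rel_ideal_add[OF _ rel_ideal_uminus, of a \<theta> h b] by simp

lemmas rel_ideal_intros = rel_ideal_add rel_ideal_diff rel_ideal_mult_left
  rel_ideal_mult_right rel_gen_in_rel_ideal

text \<open>The members of the ideal satisfying \<open>R\<close> form an ideal containing the
  generators, so minimality applies. Membership is kept in the cases because Leibniz terms such as
  \<open>dt1 h r * a\<close> need it.\<close>

lemma rel_ideal_induct [consumes 1, case_names rel zero add mult_left mult_right]:
  assumes "a \<in> rel_ideal \<theta> h"
    and rel: "\<And>n. R (rel_gen \<theta> h n)" and zero: "R 0"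
    and add: "\<And>a b. a \<in> rel_ideal \<theta> h \<Longrightarrow> R a \<Longrightarrow> b \<in> rel_ideal \<theta> h \<Longrightarrow> R b \<Longrightarrow> R (a + b)"
    and mult_left: "\<And>a r. a \<in> rel_ideal \<theta> h \<Longrightarrow> R a \<Longrightarrow> R (r * a)"
    and mult_right: "\<And>a r. a \<in> rel_ideal \<theta> h \<Longrightarrow> R a \<Longrightarrow> R (a * r)"
  shows "R a"
proof -
  let ?J = "{a \<in> rel_ideal \<theta> h. R a}"
  have "ideal ?J A3_ring"
    by (rule ideal_ring_of_type_algebraI)
      (auto intro: zero add mult_left mult_right rel_ideal_zero rel_ideal_intros)
  moreover have "range (rel_gen \<theta> h) \<subseteq> ?J"
    using rel rel_gen_in_rel_ideal by auto
  ultimately have "rel_ideal \<theta> h \<subseteq> ?J"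
    using ring.genideal_minimal[OF ring_ring_of_type_algebra] by (simp add: rel_ideal_def)
  then show ?thesis
    using assms(1) by blast
qed

section \<open>The certificates at a cyclic triple of generators\<close>

context
  fixes \<theta> h :: real and n :: 3
begin

interpretation q_cyclic_triple "scal (inverse (qpar h))" "scal (qpar h)"
  "scal (\<i> * of_real \<theta>)" "u n" "u (n + 1)" "u (n - 1)"
  by unfold_locales (simp_all add: scal_mult mult.commute, simp_all add: scal_commute)

lemma rel_gen_cyclic:
  "a = rel_gen \<theta> h n" "b = rel_gen \<theta> h (n + 1)" "c = rel_gen \<theta> h (n - 1)"
  by (simp_all add: rel_gen_def)

lemma dt1_cyclic:
  "dt1 h (u n) = dx" "dt1 h (u (n + 1)) = dy" "dt1 h (u (n - 1)) = dz"
  by (simp_all add: dt1_gen)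

lemma dt1_rel_gen: "dt1 h (rel_gen \<theta> h n) \<in> rel_ideal \<theta> h"
proof -
  have "dt1 h (rel_gen \<theta> h n) = scal (inverse (qpar h)) * (dx * u (n + 1) + u n * dy)
      - scal (qpar h) * (dy * u n + u (n + 1) * dx)"
    by (simp add: rel_gen_def dt1_diff dt1_scal dt1_scal_mult dt1_mult dt1_cyclic mult.assoc)
  then show ?thesis
    unfolding d_relation rel_gen_cyclic by (simp add: rel_ideal_intros)
qed

text \<open>The three derivatives telescope around the cycle, already in the free algebra.\<close>

lemma dt1_H1: "dt1 h H1 = 0"
  unfolding H1_cyclic[of n] dt1_add dt1_cyclic by (simp add: algebra_simps)

lemma dt1_H2: "dt1 h H2 \<in> rel_ideal \<theta> h"
proof -
  have "dt1 h H2 =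
    dx * u (n + 1) * u (n - 1) + u n * dy * u (n - 1) + u n * u (n + 1) * dz
    + (dx * u (n - 1) * u (n + 1) + u n * dz * u (n + 1) + u n * u (n - 1) * dy)
    + (dy * u n * u (n - 1) + u (n + 1) * dx * u (n - 1) + u (n + 1) * u n * dz)
    + (dy * u (n - 1) * u n + u (n + 1) * dz * u n + u (n + 1) * u (n - 1) * dx)
    + (dz * u n * u (n + 1) + u (n - 1) * dx * u (n + 1) + u (n - 1) * u n * dy)
    + (dz * u (n + 1) * u n + u (n - 1) * dy * u n + u (n - 1) * u (n + 1) * dx)"
    by (simp only: H2_cyclic[of n] dt1_add dt1_mult dt1_cyclic distrib_right)
  then show ?thesis
    unfolding d_S rel_gen_cyclic by (simp add: rel_ideal_intros)
qed

lemma H1_commutator: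
  "H1 * u n - u n * H1 - (scal (inverse (qpar h)) - scal (qpar h)) * dt1 h (u n) \<in> rel_ideal \<theta> h"
  unfolding H1_cyclic[of n] dt1_cyclic comm_sum rel_gen_cyclic
  by (simp add: rel_ideal_intros)

lemma H2_commutator:
  "H2 * u n - u n * H2 - scal (\<i> * of_real \<theta>)
      * (4 + scal (qpar h) * scal (qpar h) + scal (inverse (qpar h)) * scal (inverse (qpar h)))
      * dt1 h (u n) \<in> rel_ideal \<theta> h"
  unfolding H2_cyclic[of n] dt1_cyclic comm_S rel_gen_cyclic
  by (intro rel_ideal_intros)

lemma H2_reduced:
  "H2 - (3 * (scal (qpar h) * scal (qpar h) + 1) * u (n - 1) * u (n + 1) * u n
      + scal (\<i> * of_real \<theta>) * ((2 * scal (qpar h) + scal (inverse (qpar h))) * (u n + u (n - 1))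
      - (scal (qpar h) + 2 * scal (inverse (qpar h))) * u (n + 1))) \<in> rel_ideal \<theta> h"
  unfolding H2_cyclic[of n] S_reduced rel_gen_cyclic
  by (intro rel_ideal_intros)

end


section \<open>Stability of the ideal, and commutators with trigonometric coefficients\<close>

lemma dt1_rel_ideal: "a \<in> rel_ideal \<theta> h \<Longrightarrow> dt1 h a \<in> rel_ideal \<theta> h"
proof (induction a rule: rel_ideal_induct)
  case zero
  show ?case
    using dt1_scal[of h 0] by (simp add: rel_ideal_zero)
qed (auto simp: dt1_rel_gen dt1_add dt1_mult intro: rel_ideal_intros)

lemma dagger_rel_ideal: "a \<in> rel_ideal \<theta> h \<Longrightarrow> dagger a \<in> rel_ideal \<theta> h"
proof (induction a rule: rel_ideal_induct)
  case zero
  show ?case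
    using dagger_scal[of 0] by (simp add: rel_ideal_zero)
qed (auto simp: dagger_rel_gen dagger_add dagger_mult intro: rel_ideal_intros rel_ideal_uminus)

lemma scal_inverse_qpar_minus_qpar:
  "scal (inverse (qpar h)) - scal (qpar h) = scal (- 2 * \<i> * of_real (sin h))"
  by (simp only: inverse_qpar_minus_qpar flip: scal_minus)

text \<open>As \<open>q^2 + q^-2 = 2 cos (2 h)\<close>, the bracket is twice
  \<open>2 + cos (2 h)\<close>; the result is the scalar inverted in the second Heisenberg
  form.\<close>

lemma scal_qpar_squares:
  "scal (\<i> * of_real \<theta>)
      * (4 + scal (qpar h) * scal (qpar h) + scal (inverse (qpar h)) * scal (inverse (qpar h)))
    = scal (2 * \<i> * of_real \<theta> * (2 + of_real (cos (2 * h))))"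
proof -
  have squares: "4 + scal (qpar h) * scal (qpar h) + scal (inverse (qpar h)) * scal (inverse (qpar h))
      = scal (4 + (qpar h * qpar h + inverse (qpar h) * inverse (qpar h)))"
    by (simp add: scal_add scal_mult scal_numeral add.assoc)
  show ?thesis
    unfolding squares unfolding scal_mult qpar_squares by (simp add: algebra_simps)
qed

lemmas H1_commutator_sin = H1_commutator[unfolded scal_inverse_qpar_minus_qpar]
lemmas H2_commutator_cos = H2_commutator[unfolded scal_qpar_squares]

lemma H_central_commutator: "H_central \<theta> h * u n - u n * H_central \<theta> h \<in> rel_ideal \<theta> h"
proof -
  let ?s = "of_real (sin h) :: complex" and ?t = "of_real (\<theta> * (2 + cos (2 * h))) :: complex"
  let ?k1 = "- 2 * \<i> * of_real (sin h)"
  let ?k2 = "2 * \<i> * of_real \<theta> * (2 + of_real (cos (2 * h)))"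
  have "scal ?s * (scal ?k2 * dt1 h (u n)) + scal ?t * (scal ?k1 * dt1 h (u n))
      = scal (?s * ?k2 + ?t * ?k1) * dt1 h (u n)"
    by (simp only: scal_mult scal_add distrib_right flip: mult.assoc)
  also have "?s * ?k2 + ?t * ?k1 = 0"
    by (simp add: algebra_simps)
  finally have cancel: "scal ?s * (scal ?k2 * dt1 h (u n)) + scal ?t * (scal ?k1 * dt1 h (u n)) = 0"
    by simp
  \<comment> \<open>The subtracted bracket vanishes by \<open>cancel\<close>; its two terms are what
    each commutator needs to fall into the ideal separately.\<close>
  have "H_central \<theta> h * u n - u n * H_central \<theta> h =
      scal ?s * (H2 * u n - u n * H2) + scal ?t * (H1 * u n - u n * H1)
      - (scal ?s * (scal ?k2 * dt1 h (u n)) + scal ?t * (scal ?k1 * dt1 h (u n)))"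
    unfolding cancel
    by (simp add: H_central_def distrib_left distrib_right right_diff_distrib mult.assoc
        scal_left_commute[of "u n"])
  also have "\<dots> = scal ?s * (H2 * u n - u n * H2 - scal ?k2 * dt1 h (u n))
      + scal ?t * (H1 * u n - u n * H1 - scal ?k1 * dt1 h (u n))"
    by (simp only: distrib_left right_diff_distrib add_diff_add)
  finally have "H_central \<theta> h * u n - u n * H_central \<theta> h = \<dots>" .
  then show ?thesis
    by (simp only: rel_ideal_add rel_ideal_mult_left H1_commutator_sin H2_commutator_cos)
qed

section \<open>The quotient algebra\<close>

lemma ring_hom_ring_quot_class: "ring_hom_ring A3_ring (quot_alg \<theta> h) (quot_class \<theta> h)"
  using ideal.rcos_ring_hom_ring[OF ideal_rel_ideal]
  by (simp add: quot_alg_def quot_class_def[abs_def])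

lemma mem_quot_class: "b \<in> quot_class \<theta> h a \<longleftrightarrow> b - a \<in> rel_ideal \<theta> h"
  by (auto simp: quot_class_def a_r_coset_def' algebra_simps intro: bexI[of _ "b - a"])

lemma quot_class_eq_iff: "quot_class \<theta> h a = quot_class \<theta> h b \<longleftrightarrow> a - b \<in> rel_ideal \<theta> h"
proof
  assume "quot_class \<theta> h a = quot_class \<theta> h b"
  then show "a - b \<in> rel_ideal \<theta> h"
    using mem_quot_class[of a \<theta> h a] mem_quot_class[of a \<theta> h b] rel_ideal_zero by simp
next
  assume ab: "a - b \<in> rel_ideal \<theta> h"
  have "x - a \<in> rel_ideal \<theta> h \<longleftrightarrow> x - b \<in> rel_ideal \<theta> h" for x
    using rel_ideal_add[OF _ ab, of "x - a"] rel_ideal_diff[OF _ ab, of "x - b"] by auto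
  then show "quot_class \<theta> h a = quot_class \<theta> h b"
    by (auto simp: mem_quot_class)
qed

lemma carrier_quot_alg: "carrier (quot_alg \<theta> h) = range (quot_class \<theta> h)"
  by (auto simp: quot_alg_def quot_class_def FactRing_def A_RCOSETS_def')

lemma
  quot_class_mult: "quot_class \<theta> h a \<otimes>\<^bsub>quot_alg \<theta> h\<^esub> quot_class \<theta> h b = quot_class \<theta> h (a * b)" and
  quot_class_minus: "quot_class \<theta> h a \<ominus>\<^bsub>quot_alg \<theta> h\<^esub> quot_class \<theta> h b = quot_class \<theta> h (a - b)" and
  quot_class_zero: "\<zero>\<^bsub>quot_alg \<theta> h\<^esub> = quot_class \<theta> h 0"
proof -
  interpret hom: ring_hom_ring A3_ring "quot_alg \<theta> h" "quot_class \<theta> h"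
    by (rule ring_hom_ring_quot_class)
  show "quot_class \<theta> h a \<otimes>\<^bsub>quot_alg \<theta> h\<^esub> quot_class \<theta> h b = quot_class \<theta> h (a * b)"
    using hom.hom_mult[of a b] by simp
  show "quot_class \<theta> h a \<ominus>\<^bsub>quot_alg \<theta> h\<^esub> quot_class \<theta> h b = quot_class \<theta> h (a - b)"
    using hom.hom_add[of a "- b"] hom.hom_a_inv[of b] by (simp add: a_minus_def)
  show "\<zero>\<^bsub>quot_alg \<theta> h\<^esub> = quot_class \<theta> h 0"
    using hom.hom_zero by simp
qed

lemma ring_commutator_quot_class:
  "ring_commutator (quot_alg \<theta> h) (quot_class \<theta> h a) (quot_class \<theta> h b)
    = quot_class \<theta> h (a * b - b * a)"
  by (simp add: ring_commutator_def quot_class_mult quot_class_minus)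

lemma quot_scale_quot_class: "quot_scale \<theta> h k (quot_class \<theta> h a) = quot_class \<theta> h (scal k * a)"
  by (simp add: quot_scale_def quot_class_mult)

text \<open>Representatives of a class differ by an element of the ideal, which \<open>f\<close>
  keeps there, so the image is a singleton. Compatibility with differences covers the
  conjugate-linear \<open>dagger\<close> as well as \<open>dt1 h\<close>.\<close>

lemma quot_map_quot_class:
  assumes "\<And>a b. f (a - b) = f a - f b" "\<And>a. a \<in> rel_ideal \<theta> h \<Longrightarrow> f a \<in> rel_ideal \<theta> h"
  shows "quot_map \<theta> h f (quot_class \<theta> h a) = quot_class \<theta> h (f a)"
proof -
  have "a \<in> quot_class \<theta> h a"
    by (simp add: mem_quot_class rel_ideal_zero)
  moreover have "quot_class \<theta> h (f b) = quot_class \<theta> h (f a)" if "b \<in> quot_class \<theta> h a" for b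
    using that assms(2)[of "b - a"] by (simp add: quot_class_eq_iff mem_quot_class assms(1))
  ultimately show ?thesis
    unfolding quot_map_def
    by (intro the_elem_image_unique) blast+
qed

lemma quot_class_central_iff:
  "ring_central (quot_alg \<theta> h) (quot_class \<theta> h z) \<longleftrightarrow> (\<forall>a. z * a - a * z \<in> rel_ideal \<theta> h)"
  by (auto simp: ring_central_def carrier_quot_alg quot_class_mult quot_class_eq_iff)

text \<open>The commutator with \<open>z\<close> vanishes on scalars, is additive and obeys the
  Leibniz rule, so its values lie in the ideal once those on generators do.\<close>

lemma quot_class_centralI:
  assumes "\<And>n. z * u n - u n * z \<in> rel_ideal \<theta> h"
  shows "ring_central (quot_alg \<theta> h) (quot_class \<theta> h z)"
proof -
  have "z * a - a * z \<in> rel_ideal \<theta> h" for a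
  proof (induction a rule: free_alg_induct_gen)
    case (scal k)
    show ?case
      by (simp add: scal_commute[of k z] rel_ideal_zero)
  next
    case (gen n)
    show ?case
      using assms[of n] by (simp add: u_def)
  next
    case (add p r)
    have "z * (p + r) - (p + r) * z = (z * p - p * z) + (z * r - r * z)"
      by (simp add: algebra_simps)
    then show ?case
      using add by (simp add: rel_ideal_add)
  next
    case (mult p r)
    have "z * (p * r) - p * r * z = (z * p - p * z) * r + p * (z * r - r * z)"
      by (simp add: algebra_simps)
    then show ?case
      using mult by (simp only: rel_ideal_intros)
  qed
  then show ?thesis
    by (simp add: quot_class_central_iff)
qed

text \<open>Solves a commutator congruence for the derivative: \<open>b\<close> will be the
  commutator, \<open>a\<close> the derivative, and \<open>c\<close> inverts its coefficient
  \<open>k\<close>.\<close>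

lemma quot_class_eq_scaled_commutator:
  assumes "b - scal k * a \<in> rel_ideal \<theta> h" "c * k = 1"
  shows "quot_class \<theta> h a = quot_class \<theta> h (scal c * b)"
proof -
  have "scal c * (scal k * a) = a"
    using assms(2) by (simp add: scal_mult flip: mult.assoc)
  then have "a - scal c * b = - (scal c * (b - scal k * a))"
    by (simp add: algebra_simps)
  then show ?thesis
    using assms(1) by (simp add: quot_class_eq_iff rel_ideal_uminus rel_ideal_mult_left)
qed

theorem mainTheorem5:
  fixes h \<theta> :: real
  assumes "0 \<le> h" and "h < pi"
  shows
    "let I = rel_ideal \<theta> h;
         A = quot_alg \<theta> h;
         cl = quot_class \<theta> h;
         D = quot_map \<theta> h (dt1 h);
         dag = quot_map \<theta> h dagger;
         scale = quot_scale \<theta> h;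
         comm = ring_commutator A
     in
       \<comment> \<open>stability of the ideal\<close>
       (dt1 h ` I \<subseteq> I \<and> dagger ` I = I) \<and>
       \<comment> \<open>the induced maps are well defined; first integrals\<close>
       ((\<forall>a. D (cl a) = cl (dt1 h a)) \<and>
        (\<forall>a. dag (cl a) = cl (dagger a)) \<and>
        dag (cl H1) = cl H1 \<and> dag (cl H2) = cl H2 \<and>
        D (cl H1) = \<zero>\<^bsub>A\<^esub> \<and> D (cl H2) = \<zero>\<^bsub>A\<^esub> \<and>
        cl H2 =
          cl (scal (3 * ((qpar h)\<^sup>2 + 1)) * u 3 * u 2 * u 1
            + scal (\<i> * of_real \<theta>) *
                (scal (2 * qpar h + inverse (qpar h)) * (u 1 + u 3)
                  - scal (qpar h + 2 * inverse (qpar h)) * u 2))) \<and>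
       \<comment> \<open>central element\<close>
       ring_central A (cl (H_central \<theta> h)) \<and>
       \<comment> \<open>Heisenberg forms\<close>
       (\<forall>n :: 3.
         (h \<noteq> 0 \<longrightarrow>
           D (cl (u n)) = scale (\<i> / (2 * of_real (sin h))) (comm (cl H1) (cl (u n)))) \<and>
         (\<theta> \<noteq> 0 \<longrightarrow>
           D (cl (u n)) =
             scale (- \<i> / (2 * of_real \<theta> * (2 + of_real (cos (2 * h)))))
               (comm (cl H2) (cl (u n))))) \<and>
       \<comment> \<open>bi-quantum structure\<close>
       (\<theta> \<noteq> 0 \<and> h = 0 \<longrightarrow>
         ring_central A (cl H1) \<and>
         (\<forall>n :: 3. D (cl (u n)) = scale (- \<i> / (6 * of_real \<theta>)) (comm (cl H2) (cl (u n))))) \<and>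
       (\<theta> = 0 \<and> 0 < h \<longrightarrow>
         cl H2 = cl (scal (3 * (1 + (qpar h)\<^sup>2)) * u 3 * u 2 * u 1) \<and>
         ring_central A (cl H2) \<and>
         (\<forall>n :: 3. D (cl (u n)) =
            scale (\<i> / (2 * of_real (sin h))) (comm (cl H1) (cl (u n)))))"
proof -
  let ?cl = "quot_class \<theta> h"
  have D: "quot_map \<theta> h (dt1 h) (?cl a) = ?cl (dt1 h a)" for a
    by (rule quot_map_quot_class) (simp_all add: dt1_diff dt1_rel_ideal)
  have dag: "quot_map \<theta> h dagger (?cl a) = ?cl (dagger a)" for a
    by (rule quot_map_quot_class) (simp_all add: dagger_diff dagger_rel_ideal)
  have dagger_ideal: "dagger ` rel_ideal \<theta> h = rel_ideal \<theta> h"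
  proof
    show "dagger ` rel_ideal \<theta> h \<subseteq> rel_ideal \<theta> h"
      using dagger_rel_ideal by blast
    \<comment> \<open>By involutivity each element of the ideal is the image of its own
      conjugate.\<close>
    show "rel_ideal \<theta> h \<subseteq> dagger ` rel_ideal \<theta> h"
      using dagger_rel_ideal dagger_dagger by (metis imageI subsetI)
  qed
  have D_H1: "?cl (dt1 h H1) = ?cl 0" and D_H2: "?cl (dt1 h H2) = ?cl 0"
    by (simp_all add: dt1_H1 quot_class_eq_iff dt1_H2)
  \<comment> \<open>At \<open>n = 1\<close> the normal order
    \<open>u (n - 1) * u (n + 1) * u n\<close> reads \<open>u 3 * u 2 * u 1\<close>.\<close>
  have H2: "?cl H2 = ?cl (scal (3 * ((qpar h)\<^sup>2 + 1)) * u 3 * u 2 * u 1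
      + scal (\<i> * of_real \<theta>) * (scal (2 * qpar h + inverse (qpar h)) * (u 1 + u 3)
      - scal (qpar h + 2 * inverse (qpar h)) * u 2))"
    using H2_reduced[where n = 1 and h = h and \<theta> = \<theta>]
    by (simp add: quot_class_eq_iff power2_eq_square scal_add scal_numeral u_wrap flip: scal_mult)
  have central: "ring_central (quot_alg \<theta> h) (?cl (H_central \<theta> h))"
    by (intro quot_class_centralI H_central_commutator)
  have heis1: "?cl (dt1 h (u n)) = quot_scale \<theta> h (\<i> / (2 * of_real (sin h)))
      (ring_commutator (quot_alg \<theta> h) (?cl H1) (?cl (u n)))" if "h \<noteq> 0" for n
  proof -
    \<comment> \<open>Here \<open>h\<close> lies strictly between 0 and \<open>pi\<close>, where the
      sine is positive.\<close>
    have "sin h \<noteq> 0"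
      using that assms sin_gt_zero[of h] by simp
    then show ?thesis
      unfolding ring_commutator_quot_class quot_scale_quot_class
      by (intro quot_class_eq_scaled_commutator[OF H1_commutator_sin]) (simp add: field_simps)
  qed
  have heis2: "?cl (dt1 h (u n)) = quot_scale \<theta> h (- \<i> / (2 * of_real \<theta> * (2 + of_real (cos (2 * h)))))
      (ring_commutator (quot_alg \<theta> h) (?cl H2) (?cl (u n)))" if "\<theta> \<noteq> 0" for n
  proof -
    \<comment> \<open>This factor is at least 1, so for nonzero \<theta> the coefficient is
      invertible.\<close>
    have "2 + cos (2 * h) \<noteq> 0"
      using cos_ge_minus_one[of "2 * h"] by linarith
    then have "2 + of_real (cos (2 * h)) \<noteq> (0 :: complex)"
      by (metis of_real_add of_real_eq_0_iff of_real_numeral)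
    moreover have "- \<i> / (2 * t * w) * (2 * \<i> * t * w) = 1" if "t \<noteq> 0" "w \<noteq> 0" for t w :: complex
      using that by (simp add: field_simps)
    ultimately show ?thesis
      unfolding ring_commutator_quot_class quot_scale_quot_class using that
      by (intro quot_class_eq_scaled_commutator[OF H2_commutator_cos]) simp
  qed
  \<comment> \<open>The coefficient in the commutators of \<open>H1\<close> contains
    \<open>sin h\<close>, that of \<open>H2\<close> contains \<theta>; each vanishes in its limiting
    case.\<close>
  have central1: "ring_central (quot_alg \<theta> h) (?cl H1)" if "h = 0"
    using that H1_commutator_sin[where h = h and \<theta> = \<theta>] by (intro quot_class_centralI) simp
  have central2: "ring_central (quot_alg \<theta> h) (?cl H2)" if "\<theta> = 0"
    using that H2_commutator_cos[where h = h and \<theta> = \<theta>] by (intro quot_class_centralI) simp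
  \<comment> \<open>\<open>cos 0 = 1\<close> turns \<open>2 * \<theta> * (2 + cos (2 * h))\<close>
    into \<open>6 * \<theta>\<close>.\<close>
  have heis2': "?cl (dt1 h (u n)) = quot_scale \<theta> h (- \<i> / (6 * of_real \<theta>))
      (ring_commutator (quot_alg \<theta> h) (?cl H2) (?cl (u n)))" if "\<theta> \<noteq> 0" "h = 0" for n
    using heis2[of n] that by (simp add: mult.commute)
  have H2': "?cl H2 = ?cl (scal (3 * (1 + (qpar h)\<^sup>2)) * u 3 * u 2 * u 1)" if "\<theta> = 0"
    using H2 that by (simp add: add.commute)
  show ?thesis
    unfolding Let_def D dag quot_class_zero dagger_H1 dagger_H2
    using D_H1 D_H2 H2 central heis1 heis2 central1 central2 heis2' H2' dt1_rel_ideal dagger_ideal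
    by (intro conjI allI impI) (auto simp del: inverse_eq_divide)
qed

end
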